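(* Let $\mathbb{K}$ be an algebraically closed field of characteristic $0$, let $(\mathcal{A},\mu_0)$ be a left alternative $\mathbb{K}$-algebra and let $\mu_t$ be a one-parameter family of deformation (a formal left alternative deformation) of $\mu_0$. Then $\mu_t$ is equivalent to a deformation of the form $$\mu'_t=\mu_0+t^p\mu'_p+t^{p+1}\mu'_{p+1}+\cdots,$$ where $\mu'_p\in Z^2(\mathcal{A},\mathcal{A})$ and $\mu'_p\notin B^2(\mathcal{A},\mathcal{A})$.
   Context: A left alternative $\mathbb{K}$-algebra is a $\mathbb{K}$-vector space $\mathcal{A}$ with a bilinear multiplication $\mu_0$ (not assumed associative or unital) satisfying $\mu_0(x,\mu_0(x,y))=\mu_0(\mu_0(x,x),y)$ for all $x,y\in\mathcal{A}$. Bilinear maps are identified with linear maps $\mathcal{A}^{\otimes 2}\to\mathcal{A}$ (2-cochains). For linear $f:\mathcal{A}\to\mathcal{A}$: $\delta^1 f=\mu_0\circ(f\otimes\mathrm{id})+\mu_0\circ(\mathrm{id}\otimes f)-f\circ\mu_0$. For a 2-cochain $\phi$: $\delta^2\phi=[\mu_0\circ(\phi\otimes\mathrm{id}-\mathrm{id}\otimes\phi)+\phi\circ(\mu_0\otimes\mathrm{id}-\mathrm{id}\otimes\mu_0)]\circ(\mathrm{id}^{\otimes 3}+\sigma_1)$ with $\sigma_1(x\otimes y\otimes z)=y\otimes x\otimes z$. $Z^2(\mathcal{A},\mathcal{A})=\ker\delta^2$ and $B^2(\mathcal{A},\mathcal{A})=\operatorname{im}\delta^1$. The exponent $p$ is a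 positive integer. A formal left alternative deformation of $(\mathcal{A},\mu_0)$ is a $\mathbb{K}[[t]]$-bilinear map $\mu_t=\sum_{i\ge 0}\mu_i t^i$ on $\mathcal{A}[[t]]$, with each $\mu_i:\mathcal{A}\otimes\mathcal{A}\to\mathcal{A}$ $\mathbb{K}$-bilinear (extended $\mathbb{K}[[t]]$-bilinearly) and $\mu_0$ the given multiplication, such that for all $x,y,z\in\mathcal{A}$: $\mu_t(x\otimes\mu_t(y\otimes z))-\mu_t(\mu_t(x\otimes y)\otimes z)+\mu_t(y\otimes\mu_t(x\otimes z))-\mu_t(\mu_t(y\otimes x)\otimes z)=0$. Two deformations $\mu_t,\mu'_t$ of $\mu_0$ are equivalent if there is a $\mathbb{K}[[t]]$-linear map $\Phi_t=\mathrm{id}+\sum_{i\ge 1}t^i\Phi_i:\mathcal{A}[[t]]\to\mathcal{A}[[t]]$, with $\Phi_i\in\mathrm{End}_{\mathbb{K}}(\mathcal{A})$, such that $\Phi_t\circ\mu_t=\mu'_t\circ(\Phi_t\otimes\Phi_t)$.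
   Formalization: The formal theorem additionally assumes that the deformation is not equivalent to the constant deformation μ_0; without this the claim fails (e.g. for A = 0, where every μ'_p is 0 and lies in B^2), and in characteristic 0 it fails for every deformation equivalent to μ_0. *)

theory Defs
  imports "HOL-Computational_Algebra.Computational_Algebra"
begin

unbundle fps_syntax

definition bilinear_map ::
  "('k::field \<Rightarrow> 'a::ab_group_add \<Rightarrow> 'a) \<Rightarrow> ('a \<Rightarrow> 'a \<Rightarrow> 'a) \<Rightarrow> bool" where
  "bilinear_map scale m \<longleftrightarrow>
     (\<forall>x. Vector_Spaces.linear scale scale (m x)) \<and>
     (\<forall>y. Vector_Spaces.linear scale scale (\<lambda>x. m x y))"

locale left_alternative_algebra = vector_space scale
  for scale :: "'k::field \<Rightarrow> 'a::ab_group_add \<Rightarrow> 'a" +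
  fixes mult :: "'a \<Rightarrow> 'a \<Rightarrow> 'a"
  assumes bilinear_mult: "bilinear_map scale mult"
    and left_alternative: "mult x (mult x y) = mult (mult x x) y"

(* Linear maps from a tensor power of A are represented by curried multilinear maps on A. *)

definition delta1 :: "('a::ab_group_add \<Rightarrow> 'a \<Rightarrow> 'a) \<Rightarrow> ('a \<Rightarrow> 'a) \<Rightarrow> 'a \<Rightarrow> 'a \<Rightarrow> 'a" where
  "delta1 m f x y = m (f x) y + m x (f y) - f (m x y)"

(* The map [m o (phi x id - id x phi) + phi o (m x id - id x m)] that delta2 precomposes
   with id + sigma_1. *)
definition delta2_aux ::
  "('a::ab_group_add \<Rightarrow> 'a \<Rightarrow> 'a) \<Rightarrow> ('a \<Rightarrow> 'a \<Rightarrow> 'a) \<Rightarrow> 'a \<Rightarrow> 'a \<Rightarrow> 'a \<Rightarrow> 'a" where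
  "delta2_aux m \<phi> x y z =
     (m (\<phi> x y) z - m x (\<phi> y z)) + (\<phi> (m x y) z - \<phi> x (m y z))"

definition delta2 ::
  "('a::ab_group_add \<Rightarrow> 'a \<Rightarrow> 'a) \<Rightarrow> ('a \<Rightarrow> 'a \<Rightarrow> 'a) \<Rightarrow> 'a \<Rightarrow> 'a \<Rightarrow> 'a \<Rightarrow> 'a" where
  "delta2 m \<phi> x y z = delta2_aux m \<phi> x y z + delta2_aux m \<phi> y x z"

definition Z2 ::
  "('k::field \<Rightarrow> 'a::ab_group_add \<Rightarrow> 'a) \<Rightarrow> ('a \<Rightarrow> 'a \<Rightarrow> 'a) \<Rightarrow> ('a \<Rightarrow> 'a \<Rightarrow> 'a) set" where
  "Z2 scale m = {\<phi>. bilinear_map scale \<phi> \<and> (\<forall>x y z. delta2 m \<phi> x y z = 0)}"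

definition B2 ::
  "('k::field \<Rightarrow> 'a::ab_group_add \<Rightarrow> 'a) \<Rightarrow> ('a \<Rightarrow> 'a \<Rightarrow> 'a) \<Rightarrow> ('a \<Rightarrow> 'a \<Rightarrow> 'a) set" where
  "B2 scale m = delta1 m ` {f. Vector_Spaces.linear scale scale f}"

(* A[[t]] is the type 'a fps. A power series of K-linear (resp. K-bilinear) maps on A acts on it
   by extending each coefficient K[[t]]-linearly (resp. K[[t]]-bilinearly), i.e. by convolution. *)

definition fps_linear_ext :: "(nat \<Rightarrow> 'a::ab_group_add \<Rightarrow> 'a) \<Rightarrow> 'a fps \<Rightarrow> 'a fps" where
  "fps_linear_ext \<Phi> x = Abs_fps (\<lambda>n. \<Sum>i\<le>n. \<Phi> i (x $ (n - i)))"

definition fps_bilinear_ext ::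
  "(nat \<Rightarrow> 'a::ab_group_add \<Rightarrow> 'a \<Rightarrow> 'a) \<Rightarrow> 'a fps \<Rightarrow> 'a fps \<Rightarrow> 'a fps" where
  "fps_bilinear_ext \<mu> x y =
     Abs_fps (\<lambda>n. \<Sum>i\<le>n. \<Sum>j\<le>n - i. \<mu> i (x $ j) (y $ (n - i - j)))"

definition left_alternative_deformation ::
  "('k::field \<Rightarrow> 'a::ab_group_add \<Rightarrow> 'a) \<Rightarrow> ('a \<Rightarrow> 'a \<Rightarrow> 'a) \<Rightarrow> (nat \<Rightarrow> 'a \<Rightarrow> 'a \<Rightarrow> 'a) \<Rightarrow> bool" where
  "left_alternative_deformation scale m \<mu> \<longleftrightarrow>
     \<mu> 0 = m \<and> (\<forall>i. bilinear_map scale (\<mu> i)) \<and>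
     (\<forall>a b c. let M = fps_bilinear_ext \<mu>;
                  x = fps_const a; y = fps_const b; z = fps_const c
              in M x (M y z) - M (M x y) z + M y (M x z) - M (M y x) z = 0)"

definition equivalent_deformations ::
  "('k::field \<Rightarrow> 'a::ab_group_add \<Rightarrow> 'a) \<Rightarrow>
     (nat \<Rightarrow> 'a \<Rightarrow> 'a \<Rightarrow> 'a) \<Rightarrow> (nat \<Rightarrow> 'a \<Rightarrow> 'a \<Rightarrow> 'a) \<Rightarrow> bool" where
  "equivalent_deformations scale \<mu> \<mu>' \<longleftrightarrow>
     (\<exists>\<Phi>. \<Phi> 0 = id \<and> (\<forall>i. Vector_Spaces.linear scale scale (\<Phi> i)) \<and>
          (\<forall>x y. fps_linear_ext \<Phi> (fps_bilinear_ext \<mu> x y) =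
                 fps_bilinear_ext \<mu>' (fps_linear_ext \<Phi> x) (fps_linear_ext \<Phi> y)))"

definition null_deformation :: "('a::ab_group_add \<Rightarrow> 'a \<Rightarrow> 'a) \<Rightarrow> nat \<Rightarrow> 'a \<Rightarrow> 'a \<Rightarrow> 'a" where
  "null_deformation m i = (if i = 0 then m else (\<lambda>x y. 0))"

end

theory Submission
  imports Defs
begin

text \<open>
  A family \<open>\<Phi>\<close> with \<open>\<Phi>\<^sub>0 = id\<close> transports \<open>\<mu>\<close> to a unique equivalent deformation, whose
  coefficient \<open>n\<close> involves only \<open>\<Phi>\<^sub>0, \<dots>, \<Phi>\<^sub>n\<close>; adding \<open>f\<close> to \<open>\<Phi>\<^sub>n\<close> subtracts \<open>\<delta>\<^sup>1 f\<close> from it. The first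
  nonzero coefficient of positive degree of a deformation is a cocycle. If it were a coboundary
  after every transport, it could be killed in each degree in turn without disturbing the lower
  ones, and the diagonal of the resulting families would trivialise \<open>\<mu>\<close>.

  No inverse of \<open>\<Phi>\<close> is needed beyond its surjectivity on \<open>A[[t]]\<close>. Identities on \<open>A[[t]]\<close> are
  checked on constants, since a map that is additive and commutes with multiplication by \<open>t\<close> vanishes
  when it vanishes on constants.
\<close>

section \<open>Maps commuting with multiplication by t\<close>

text \<open>The coefficients form only an additive group, so multiplication by t is encoded as an
  index shift instead of a product of series.\<close>

definition fps_up :: "'a::zero fps \<Rightarrow> 'a fps" where
  "fps_up x = Abs_fps (\<lambda>n. case n of 0 \<Rightarrow> 0 | Suc m \<Rightarrow> x $ m)"

lemma fps_up_nth_0 [simp]: "fps_up x $ 0 = 0"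
  and fps_up_nth_Suc [simp]: "fps_up x $ Suc n = x $ n"
  by (simp_all add: fps_up_def)

lemma fps_decompose:
  fixes x :: "'a::ab_group_add fps"
  shows "x = fps_const (x $ 0) + fps_up (fps_shift 1 x)"
proof (rule fps_ext)
  show "x $ n = (fps_const (x $ 0) + fps_up (fps_shift 1 x)) $ n" for n
    by (cases n) simp_all
qed

lemma fps_up_add: "fps_up (x + y) = fps_up x + fps_up (y :: 'a::ab_group_add fps)"
  by (rule fps_ext, case_tac n) simp_all

lemma fps_up_diff: "fps_up (x - y) = fps_up x - fps_up (y :: 'a::ab_group_add fps)"
  by (rule fps_ext, case_tac n) simp_all

definition t_linear :: "('a::ab_group_add fps \<Rightarrow> 'a fps) \<Rightarrow> bool" where
  "t_linear T \<longleftrightarrow> (\<forall>x y. T (x + y) = T x + T y) \<and> (\<forall>x. T (fps_up x) = fps_up (T x))"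

text \<open>Write \<open>x\<close> as its constant term plus t times its shift. The constant
  contributes nothing, so coefficient \<open>Suc n\<close> of \<open>T x\<close> is coefficient
  \<open>n\<close> of \<open>T\<close> at the shift; the induction therefore needs \<open>x\<close>
  arbitrary.\<close>

lemma t_linear_eq_0:
  assumes T: "t_linear T" and const: "\<And>a. T (fps_const a) = 0"
  shows "T x = 0"
proof (rule fps_ext)
  show "T x $ n = 0 $ n" for n
  proof (induction n arbitrary: x)
    case 0
    then show ?case
      using T const fps_decompose[of x] unfolding t_linear_def
      by (metis add.left_neutral fps_up_nth_0 fps_zero_nth)
  next
    case (Suc n)
    then show ?case
      using T const fps_decompose[of x] unfolding t_linear_def
      by (metis add.left_neutral fps_up_nth_Suc fps_zero_nth)
  qed
qed

lemma t_linear_comp: "t_linear S \<Longrightarrow> t_linear T \<Longrightarrow> t_linear (\<lambda>x. S (T x))"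
  by (simp add: t_linear_def)

lemma t_linear_add: "t_linear S \<Longrightarrow> t_linear T \<Longrightarrow> t_linear (\<lambda>x. S x + T x)"
  by (simp add: t_linear_def fps_up_add)

lemma t_linear_diff: "t_linear S \<Longrightarrow> t_linear T \<Longrightarrow> t_linear (\<lambda>x. S x - T x)"
  by (simp add: t_linear_def fps_up_diff)

lemma t_linear_fps_linear_ext:
  assumes "\<And>i. additive (\<Phi> i)"
  shows "t_linear (fps_linear_ext \<Phi>)"
proof -
  have "fps_linear_ext \<Phi> (fps_up x) $ n = fps_up (fps_linear_ext \<Phi> x) $ n" for x n
  proof (cases n)
    case 0
    then show ?thesis
      by (simp add: fps_linear_ext_def additive.zero[OF assms])
  next
    case (Suc m)
    \<comment> \<open>The one further term, \<open>i = Suc m\<close>, meets the zero constant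
      coefficient of \<open>fps_up x\<close>.\<close>
    have "\<Phi> i (fps_up x $ (Suc m - i)) = \<Phi> i (x $ (m - i))" if "i \<le> m" for i
      using that by (simp add: Suc_diff_le)
    then show ?thesis
      by (simp add: Suc fps_linear_ext_def additive.zero[OF assms])
  qed
  then show ?thesis
    unfolding t_linear_def
    by (auto simp: fps_eq_iff fps_linear_ext_def additive.add[OF assms] sum.distrib)
qed

section \<open>Bilinear extensions to A[[t]]\<close>

locale biadditive_family =
  fixes \<mu> :: "nat \<Rightarrow> 'a::ab_group_add \<Rightarrow> 'a \<Rightarrow> 'a"
  assumes additive_right: "additive (\<mu> i x)"
    and additive_left: "additive (\<lambda>x. \<mu> i x y)"
begin

lemmas mult_zero [simp] = additive.zero[OF additive_right] additive.zero[OF additive_left]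

lemma t_linear_right: "t_linear (fps_bilinear_ext \<mu> x)"
proof -
  have "fps_bilinear_ext \<mu> x (fps_up y) $ n = fps_up (fps_bilinear_ext \<mu> x y) $ n" for y n
  proof (cases n)
    case 0
    then show ?thesis by (simp add: fps_bilinear_ext_def)
  next
    case (Suc m)
    have "(\<Sum>j\<le>Suc m - i. \<mu> i (x $ j) (fps_up y $ (Suc m - i - j))) =
          (\<Sum>j\<le>m - i. \<mu> i (x $ j) (y $ (m - i - j)))" if "i \<le> m" for i
      using that by (simp add: Suc_diff_le)
    then show ?thesis by (simp add: Suc fps_bilinear_ext_def)
  qed
  then show ?thesis
    unfolding t_linear_def
    by (auto simp: fps_eq_iff fps_bilinear_ext_def additive.add[OF additive_right] sum.distrib)
qed

lemma t_linear_left: "t_linear (\<lambda>x. fps_bilinear_ext \<mu> x y)"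
proof -
  have "fps_bilinear_ext \<mu> (fps_up x) y $ n = fps_up (fps_bilinear_ext \<mu> x y) $ n" for x n
  proof (cases n)
    case 0
    then show ?thesis by (simp add: fps_bilinear_ext_def)
  next
    case (Suc m)
    have "(\<Sum>j\<le>Suc m - i. \<mu> i (fps_up x $ j) (y $ (Suc m - i - j))) =
          (\<Sum>j\<le>m - i. \<mu> i (x $ j) (y $ (m - i - j)))" if "i \<le> m" for i
      using that by (simp add: Suc_diff_le sum.atMost_Suc_shift del: sum.atMost_Suc)
    then show ?thesis by (simp add: Suc fps_bilinear_ext_def)
  qed
  then show ?thesis
    unfolding t_linear_def
    by (auto simp: fps_eq_iff fps_bilinear_ext_def additive.add[OF additive_left] sum.distrib)
qed

lemma fps_bilinear_ext_const_left:
  "fps_bilinear_ext \<mu> (fps_const a) w $ n = (\<Sum>i\<le>n. \<mu> i a (w $ (n - i)))"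
proof -
  have "(\<Sum>j\<le>m. \<mu> i (fps_const a $ j) (w $ (m - j))) = \<mu> i a (w $ m)" for i m
  proof -
    have "(\<Sum>j\<le>m. \<mu> i (fps_const a $ j) (w $ (m - j))) =
          (\<Sum>j\<in>{0}. \<mu> i (fps_const a $ j) (w $ (m - j)))"
      by (rule sum.mono_neutral_right) auto
    then show ?thesis by simp
  qed
  then show ?thesis unfolding fps_bilinear_ext_def fps_nth_Abs_fps by (simp only:)
qed

lemma fps_bilinear_ext_const_right:
  "fps_bilinear_ext \<mu> w (fps_const a) $ n = (\<Sum>i\<le>n. \<mu> i (w $ (n - i)) a)"
proof -
  have "(\<Sum>j\<le>m. \<mu> i (w $ j) (fps_const a $ (m - j))) = \<mu> i (w $ m) a" for i m
  proof -
    have "(\<Sum>j\<le>m. \<mu> i (w $ j) (fps_const a $ (m - j))) =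
          (\<Sum>j\<in>{m}. \<mu> i (w $ j) (fps_const a $ (m - j)))"
      by (rule sum.mono_neutral_right) auto
    then show ?thesis by simp
  qed
  then show ?thesis unfolding fps_bilinear_ext_def fps_nth_Abs_fps by (simp only:)
qed

lemma fps_bilinear_ext_const_const:
  "fps_bilinear_ext \<mu> (fps_const a) (fps_const b) $ n = \<mu> n a b"
proof -
  have "(\<Sum>i\<le>n. \<mu> i a (fps_const b $ (n - i))) = (\<Sum>i\<in>{n}. \<mu> i a (fps_const b $ (n - i)))"
    by (rule sum.mono_neutral_right) auto
  then show ?thesis by (simp add: fps_bilinear_ext_const_left)
qed

text \<open>Deformations satisfy the identity on constants only, but preimages of constants under a
  formal automorphism are general series. The defect is t-linear in each variable, so it is shown to
  vanish one variable at a time.\<close>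

lemma left_alternative_extends:
  defines "M \<equiv> fps_bilinear_ext \<mu>"
  assumes "\<And>a b c. let x = fps_const a; y = fps_const b; z = fps_const c
                    in M x (M y z) - M (M x y) z + M y (M x z) - M (M y x) z = 0"
  shows "M x (M y z) - M (M x y) z + M y (M x z) - M (M y x) z = 0"
proof -
  note tl = t_linear_diff t_linear_add t_linear_right t_linear_left
    t_linear_comp[OF t_linear_right] t_linear_comp[OF t_linear_left]
  define T where "T x y z = M x (M y z) - M (M x y) z + M y (M x z) - M (M y x) z" for x y z
  have lin: "t_linear (\<lambda>x. T x y z)" "t_linear (\<lambda>y. T x y z)" "t_linear (\<lambda>z. T x y z)" for x y z
    unfolding T_def M_def by (intro tl)+
  have "T (fps_const a) (fps_const b) (fps_const c) = 0" for a b c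
    using assms(2)[of a b c] by (simp add: T_def Let_def)
  then have "T x (fps_const b) (fps_const c) = 0" for x b c
    by (rule t_linear_eq_0[OF lin(1)])
  then have "T x y (fps_const c) = 0" for x y c
    by (rule t_linear_eq_0[OF lin(2)])
  then have "T x y z = 0"
    by (rule t_linear_eq_0[OF lin(3)])
  then show ?thesis by (simp add: T_def)
qed

end

section \<open>Linear extensions: constants and surjectivity\<close>

lemma fps_linear_ext_const:
  assumes "\<And>i. additive (\<Phi> i)"
  shows "fps_linear_ext \<Phi> (fps_const a) $ n = \<Phi> n a"
proof -
  have "(\<Sum>i\<le>n. \<Phi> i (fps_const a $ (n - i))) = (\<Sum>i\<in>{n}. \<Phi> i (fps_const a $ (n - i)))"
    by (rule sum.mono_neutral_right) (auto simp: additive.zero[OF assms])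
  then show ?thesis by (simp add: fps_linear_ext_def)
qed

text \<open>For \<open>\<Phi> 0 = id\<close> the equation \<open>fps_linear_ext \<Phi> x = y\<close>
  is unitriangular in the coefficients of \<open>x\<close>; this is its solution by forward
  substitution.\<close>

fun fps_linear_preimage :: "(nat \<Rightarrow> 'a::ab_group_add \<Rightarrow> 'a) \<Rightarrow> 'a fps \<Rightarrow> nat \<Rightarrow> 'a" where
  "fps_linear_preimage \<Phi> y n =
     y $ n - (\<Sum>i<n. \<Phi> (n - i) (fps_linear_preimage \<Phi> y i))"

declare fps_linear_preimage.simps [simp del]

lemma surj_fps_linear_ext:
  assumes "\<Phi> 0 = id"
  shows "surj (fps_linear_ext \<Phi>)"
proof (rule surjI)
  fix y
  show "fps_linear_ext \<Phi> (Abs_fps (fps_linear_preimage \<Phi> y)) = y"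
  proof (rule fps_ext)
    fix n
    let ?x = "fps_linear_preimage \<Phi> y"
    have "(\<Sum>i\<le>n. \<Phi> i (?x (n - i))) = (\<Sum>i\<le>n. \<Phi> (n - i) (?x i))"
      by (rule sum.reindex_bij_witness[of _ "\<lambda>i. n - i" "\<lambda>i. n - i"]) auto
    also have "\<dots> = (\<Sum>i<n. \<Phi> (n - i) (?x i)) + ?x n"
      using assms by (simp add: lessThan_Suc_atMost[symmetric])
    also have "\<dots> = y $ n"
      by (subst (2) fps_linear_preimage.simps) simp
    finally show "fps_linear_ext \<Phi> (Abs_fps ?x) $ n = y $ n"
      by (simp add: fps_linear_ext_def)
  qed
qed

section \<open>Transport of a multiplication along a formal automorphism\<close>

text \<open>The recursion is the coefficient of degree \<open>n\<close> of \<open>\<Phi> \<circ> \<mu> = \<mu>' \<circ> (\<Phi> \<otimes> \<Phi>)\<close>, solved for \<open>\<mu>'\<^sub>n\<close>.\<close>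

fun transport ::
  "(nat \<Rightarrow> 'a::ab_group_add \<Rightarrow> 'a \<Rightarrow> 'a) \<Rightarrow> (nat \<Rightarrow> 'a \<Rightarrow> 'a) \<Rightarrow> nat \<Rightarrow> 'a \<Rightarrow> 'a \<Rightarrow> 'a" where
  "transport \<mu> \<Phi> n x y =
     (\<Sum>i\<le>n. \<Phi> i (\<mu> (n - i) x y)) -
     (\<Sum>i<n. \<Sum>j\<le>n - i. transport \<mu> \<Phi> i (\<Phi> j x) (\<Phi> (n - i - j) y))"

declare transport.simps [simp del]

lemma transport_0: "\<Phi> 0 = id \<Longrightarrow> transport \<mu> \<Phi> 0 = \<mu> 0"
  by (simp add: transport.simps[of _ _ 0] fun_eq_iff)

text \<open>Every index of \<Phi> in the recursion is at most \<open>n\<close>. Hence changing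
  \<Phi> in degree \<open>n\<close> preserves the lower coefficients, and a diagonal family can be
  compared with each stage.\<close>

lemma transport_cong:
  assumes "\<And>i. i \<le> n \<Longrightarrow> \<Phi> i = \<Psi> i"
  shows "transport \<mu> \<Phi> n = transport \<mu> \<Psi> n"
  using assms
proof (induction n rule: less_induct)
  case (less n)
  have IH: "transport \<mu> \<Phi> i = transport \<mu> \<Psi> i" if "i < n" for i
    using that by (intro less.IH less.prems) auto
  show ?case
    using less.prems by (intro ext) (simp add: transport.simps[of _ _ n] IH)
qed

text \<open>The new \<open>f\<close> acts on \<open>\<mu> 0 x y\<close> in the first sum, and in the
  second only where \<open>i = 0\<close>; for larger \<open>i\<close> all indices of \<Phi> stay
  below \<open>n\<close>. Together these terms give minus the coboundary.\<close>

lemma transport_add: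
  fixes \<mu> :: "nat \<Rightarrow> 'a::ab_group_add \<Rightarrow> 'a \<Rightarrow> 'a"
  assumes \<mu>: "biadditive_family \<mu>" and \<Phi>0: "\<Phi> 0 = id" and n: "n > 0"
  shows "transport \<mu> (\<Phi>(n := \<lambda>x. \<Phi> n x + f x)) n x y =
         transport \<mu> \<Phi> n x y - delta1 (\<mu> 0) f x y"
proof -
  interpret biadditive_family \<mu> by fact
  obtain k where k: "n = Suc k" using n gr0_implies_Suc by blast
  define \<Psi> where "\<Psi> = \<Phi>(n := \<lambda>x. \<Phi> n x + f x)"
  have \<Psi>_less [simp]: "\<Psi> i = \<Phi> i" if "i \<le> k" for i
    using that by (simp add: \<Psi>_def k)
  have \<Psi>_n [simp]: "\<Psi> (Suc k) x = \<Phi> (Suc k) x + f x" for x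
    by (simp add: \<Psi>_def k)
  have eq: "transport \<mu> \<Psi> i = transport \<mu> \<Phi> i" if "i \<le> k" for i
    using that by (intro transport_cong) simp
  have tr0: "transport \<mu> \<Phi> 0 = \<mu> 0" using \<Phi>0 by (rule transport_0)
  have low: "(\<Sum>j\<le>k - i. transport \<mu> \<Psi> (Suc i) (\<Psi> j x) (\<Psi> (k - i - j) y)) =
             (\<Sum>j\<le>k - i. transport \<mu> \<Phi> (Suc i) (\<Phi> j x) (\<Phi> (k - i - j) y))" if "i < k" for i
    using that by (simp add: eq)
  \<comment> \<open>Only the ends \<open>j = 0\<close> and \<open>j = Suc k\<close> involve
    \<open>\<Psi> (Suc k)\<close>, and there the other factor is
    \<open>\<Phi> 0 = id\<close>.\<close>
  have zero: "(\<Sum>j\<le>Suc k. \<mu> 0 (\<Psi> j x) (\<Psi> (Suc k - j) y)) =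
              (\<Sum>j\<le>Suc k. \<mu> 0 (\<Phi> j x) (\<Phi> (Suc k - j) y)) + \<mu> 0 x (f y) + \<mu> 0 (f x) y"
  proof -
    have "(\<Sum>j<k. \<mu> 0 (\<Psi> (Suc j) x) (\<Psi> (k - j) y)) = (\<Sum>j<k. \<mu> 0 (\<Phi> (Suc j) x) (\<Phi> (k - j) y))"
      by (simp add: Suc_leI)
    then show ?thesis
      by (simp add: sum.atMost_Suc_shift lessThan_Suc_atMost[symmetric] \<Phi>0 additive.add[OF additive_right]
          additive.add[OF additive_left] sum.lessThan_Suc_shift[of _ "Suc k"] del: sum.lessThan_Suc)
         (simp add: \<Phi>0 additive.add[OF additive_left] algebra_simps)
  qed
  have "transport \<mu> \<Psi> (Suc k) x y =
        (\<Sum>i\<le>Suc k. \<Psi> i (\<mu> (Suc k - i) x y)) - ((\<Sum>j\<le>Suc k. \<mu> 0 (\<Psi> j x) (\<Psi> (Suc k - j) y)) +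
        (\<Sum>i<k. \<Sum>j\<le>k - i. transport \<mu> \<Psi> (Suc i) (\<Psi> j x) (\<Psi> (k - i - j) y)))"
    by (subst transport.simps) (simp add: sum.lessThan_Suc_shift eq tr0 del: sum.lessThan_Suc sum.atMost_Suc)
  also have "\<dots> = (\<Sum>i\<le>Suc k. \<Phi> i (\<mu> (Suc k - i) x y)) + f (\<mu> 0 x y) -
       ((\<Sum>j\<le>Suc k. \<mu> 0 (\<Phi> j x) (\<Phi> (Suc k - j) y)) + \<mu> 0 x (f y) + \<mu> 0 (f x) y +
        (\<Sum>i<k. \<Sum>j\<le>k - i. transport \<mu> \<Phi> (Suc i) (\<Phi> j x) (\<Phi> (k - i - j) y)))"
    unfolding zero using low by simp
  also have "\<dots> = transport \<mu> \<Phi> (Suc k) x y - delta1 (\<mu> 0) f x y"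
    by (subst transport.simps)
       (simp add: sum.lessThan_Suc_shift tr0 delta1_def algebra_simps del: sum.lessThan_Suc sum.atMost_Suc)
  finally show ?thesis by (simp add: \<Psi>_def k)
qed

lemma transport_fps_ext:
  assumes \<mu>: "biadditive_family \<mu>" and \<nu>: "biadditive_family (transport \<mu> \<Phi>)"
    and \<Phi>: "\<And>i. additive (\<Phi> i)" and \<Phi>0: "\<Phi> 0 = id"
  shows "fps_linear_ext \<Phi> (fps_bilinear_ext \<mu> x y) =
         fps_bilinear_ext (transport \<mu> \<Phi>) (fps_linear_ext \<Phi> x) (fps_linear_ext \<Phi> y)"
proof -
  interpret m: biadditive_family \<mu> by fact
  interpret n: biadditive_family "transport \<mu> \<Phi>" by fact
  note L = t_linear_fps_linear_ext[of \<Phi>, OF \<Phi>]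
  define T where "T x y = fps_linear_ext \<Phi> (fps_bilinear_ext \<mu> x y) -
    fps_bilinear_ext (transport \<mu> \<Phi>) (fps_linear_ext \<Phi> x) (fps_linear_ext \<Phi> y)" for x y
  have lin: "t_linear (\<lambda>x. T x y)" "t_linear (\<lambda>y. T x y)" for x y
    unfolding T_def
    by (intro t_linear_diff t_linear_comp[OF L] t_linear_comp[OF n.t_linear_left L]
        t_linear_comp[OF n.t_linear_right L] m.t_linear_left m.t_linear_right)+
  have "T (fps_const a) (fps_const b) = 0" for a b
  proof (rule fps_ext)
    fix n
    have "fps_linear_ext \<Phi> (fps_bilinear_ext \<mu> (fps_const a) (fps_const b)) $ n =
          (\<Sum>i\<le>n. \<Phi> i (\<mu> (n - i) a b))"
      by (simp add: fps_linear_ext_def m.fps_bilinear_ext_const_const)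
    \<comment> \<open>The recursion for \<open>transport\<close>, with the subtracted terms moved
      across; the term \<open>i = n\<close> is \<open>transport \<mu> \<Phi> n a b\<close>, as
      \<open>\<Phi> 0 = id\<close>.\<close>
    also have "\<dots> = (\<Sum>i\<le>n. \<Sum>j\<le>n - i. transport \<mu> \<Phi> i (\<Phi> j a) (\<Phi> (n - i - j) b))"
      using transport.simps[of \<mu> \<Phi> n a b]
      by (simp add: lessThan_Suc_atMost[symmetric] sum.lessThan_Suc[of _ n] \<Phi>0 algebra_simps
          del: sum.lessThan_Suc) (simp add: \<Phi>0)
    finally show "T (fps_const a) (fps_const b) $ n = 0 $ n"
      by (simp add: T_def fps_bilinear_ext_def[of "transport \<mu> \<Phi>"] fps_linear_ext_const \<Phi>)
  qed
  then have "T x (fps_const b) = 0" for x b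
    by (rule t_linear_eq_0[OF lin(1)])
  then have "T x y = 0"
    by (rule t_linear_eq_0[OF lin(2)])
  then show ?thesis by (simp add: T_def)
qed

section \<open>Deformations\<close>

lemma linear_imp_additive: "Vector_Spaces.linear s s' f \<Longrightarrow> additive f"
  by (rule additive.intro, rule module_hom.add, erule Vector_Spaces.linear.axioms(3))

lemma bilinear_imp_biadditive: "(\<And>i. bilinear_map scale (\<mu> i)) \<Longrightarrow> biadditive_family \<mu>"
  by (intro biadditive_family.intro linear_imp_additive[of scale scale]) (simp_all add: bilinear_map_def)

lemma bilinear_transport:
  assumes "vector_space scale" and \<mu>: "\<And>i. bilinear_map scale (\<mu> i)"
    and \<Phi>: "\<And>i. Vector_Spaces.linear scale scale (\<Phi> i)"
  shows "bilinear_map scale (transport \<mu> \<Phi> n)"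
proof (induction n rule: less_induct)
  case (less n)
  interpret vector_space scale by fact
  interpret vector_space_pair scale scale ..
  have comp: "Vector_Spaces.linear scale scale (\<lambda>x. g (h x))"
    if "Vector_Spaces.linear scale scale h" "Vector_Spaces.linear scale scale g" for g h
    using Vector_Spaces.linear_compose[OF that] by (simp add: o_def)
  have \<mu>r: "Vector_Spaces.linear scale scale (\<lambda>y. \<mu> i x y)"
    and \<mu>l: "Vector_Spaces.linear scale scale (\<lambda>x. \<mu> i x y)" for i x y
    using \<mu>[of i] by (simp_all add: bilinear_map_def)
  have tr: "Vector_Spaces.linear scale scale (\<lambda>y. transport \<mu> \<Phi> i x y)"
    and tl: "Vector_Spaces.linear scale scale (\<lambda>x. transport \<mu> \<Phi> i x y)" if "i < n" for i x y
    using less[OF that] by (simp_all add: bilinear_map_def)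
  have "Vector_Spaces.linear scale scale (\<lambda>y. transport \<mu> \<Phi> n x y)" for x
    unfolding transport.simps[of \<mu> \<Phi> n]
    by (intro linear_compose_sub linear_compose_sum ballI comp[OF \<mu>r \<Phi>] comp[OF \<Phi> tr]) simp
  moreover have "Vector_Spaces.linear scale scale (\<lambda>x. transport \<mu> \<Phi> n x y)" for y
    unfolding transport.simps[of \<mu> \<Phi> n]
    by (intro linear_compose_sub linear_compose_sum ballI comp[OF \<mu>l \<Phi>] comp[OF \<Phi> tl]) simp
  ultimately show ?case by (simp add: bilinear_map_def)
qed

lemma transport_deformation:
  assumes vs: "vector_space scale" and def: "left_alternative_deformation scale m \<mu>"
    and \<Phi>: "\<And>i. Vector_Spaces.linear scale scale (\<Phi> i)" and \<Phi>0: "\<Phi> 0 = id"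
  shows "left_alternative_deformation scale m (transport \<mu> \<Phi>)"
    and "equivalent_deformations scale \<mu> (transport \<mu> \<Phi>)"
proof -
  have bil: "bilinear_map scale (\<mu> i)" for i
    using def by (simp add: left_alternative_deformation_def)
  have bil': "bilinear_map scale (transport \<mu> \<Phi> i)" for i
    by (rule bilinear_transport[OF vs bil \<Phi>])
  have \<mu>: "biadditive_family \<mu>" and \<nu>: "biadditive_family (transport \<mu> \<Phi>)"
    using bil bil' by (blast intro: bilinear_imp_biadditive)+
  have add: "additive (\<Phi> i)" for i
    using \<Phi> by (rule linear_imp_additive)
  let ?L = "fps_linear_ext \<Phi>" and ?M = "fps_bilinear_ext \<mu>"
    and ?N = "fps_bilinear_ext (transport \<mu> \<Phi>)"
  have hom: "?N (?L x) (?L y) = ?L (?M x y)" for x y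
    using transport_fps_ext[OF \<mu> \<nu> add \<Phi>0] by simp
  then show "equivalent_deformations scale \<mu> (transport \<mu> \<Phi>)"
    unfolding equivalent_deformations_def using \<Phi> \<Phi>0 by metis
  have la: "?M x (?M y z) - ?M (?M x y) z + ?M y (?M x z) - ?M (?M y x) z = 0" for x y z
    using def unfolding left_alternative_deformation_def Let_def
    by (intro biadditive_family.left_alternative_extends[OF \<mu>]) (simp add: Let_def)
  interpret L: additive ?L
    using t_linear_fps_linear_ext[of \<Phi>, OF add] by (simp add: additive_def t_linear_def)
  have "?N x (?N y z) - ?N (?N x y) z + ?N y (?N x z) - ?N (?N y x) z = 0" for x y z
  proof -
    \<comment> \<open>Pulled back along the surjection \<open>?L\<close>, the identity for
      \<open>?N\<close> becomes the \<open>?L\<close>-image of the identity for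
      \<open>?M\<close>.\<close>
    obtain x' y' z' where "x = ?L x'" "y = ?L y'" "z = ?L z'"
      using surj_fps_linear_ext[of \<Phi>, OF \<Phi>0] by (metis surjD)
    then show ?thesis
      using la[of x' y' z'] by (simp add: hom L.zero flip: L.add L.diff)
  qed
  then show "left_alternative_deformation scale m (transport \<mu> \<Phi>)"
    using bil' def \<Phi>0
    by (simp add: left_alternative_deformation_def transport_0 Let_def)
qed

text \<open>In degree \<open>p\<close> of the identity on constants, only products of
  \<open>\<mu> 0\<close> with \<open>\<mu> p\<close> survive, and their sum is minus
  \<open>delta2 m (\<mu> p)\<close>.\<close>

lemma leading_coefficient_in_Z2:
  assumes def: "left_alternative_deformation scale m \<mu>" and p: "p > 0"
    and low: "\<And>i. 0 < i \<Longrightarrow> i < p \<Longrightarrow> \<mu> i = (\<lambda>x y. 0)"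
  shows "\<mu> p \<in> Z2 scale m"
proof -
  have bil: "\<And>i. bilinear_map scale (\<mu> i)" and \<mu>0: "\<mu> 0 = m"
    using def by (simp_all add: left_alternative_deformation_def)
  interpret biadditive_family \<mu> using bil by (rule bilinear_imp_biadditive)
  have ends: "(\<Sum>i\<le>p. g i) = g 0 + g p"
    if "\<And>i. 0 < i \<Longrightarrow> i < p \<Longrightarrow> g i = (0::'b)" for g :: "nat \<Rightarrow> 'b"
  proof -
    have "(\<Sum>i\<le>p. g i) = (\<Sum>i\<in>{0, p}. g i)"
      using that by (intro sum.mono_neutral_right) auto
    then show ?thesis using p by simp
  qed
  have "delta2 m (\<mu> p) a b c = 0" for a b c
  proof -
    let ?M = "fps_bilinear_ext \<mu>" and ?x = "fps_const a" and ?y = "fps_const b" and ?z = "fps_const c"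
    have "(?M ?x (?M ?y ?z) - ?M (?M ?x ?y) ?z + ?M ?y (?M ?x ?z) - ?M (?M ?y ?x) ?z) $ p = 0"
      using def by (simp add: left_alternative_deformation_def Let_def)
    then have "(\<mu> 0 a (\<mu> p b c) + \<mu> p a (\<mu> 0 b c)) - (\<mu> 0 (\<mu> p a b) c + \<mu> p (\<mu> 0 a b) c) +
      (\<mu> 0 b (\<mu> p a c) + \<mu> p b (\<mu> 0 a c)) - (\<mu> 0 (\<mu> p b a) c + \<mu> p (\<mu> 0 b a) c) = 0"
      by (simp add: fps_bilinear_ext_const_left[of _ "?M _ _"] fps_bilinear_ext_const_right[of "?M _ _"]
          fps_bilinear_ext_const_const ends low)
    then show ?thesis
      by (simp add: delta2_def delta2_aux_def \<mu>0 algebra_simps)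
  qed
  then show ?thesis using bil by (simp add: Z2_def)
qed

section \<open>Removal of coboundaries degree by degree\<close>

theorem theorem5p11:
  fixes scale :: "'k::{alg_closed_field, field_char_0} \<Rightarrow> 'a::ab_group_add \<Rightarrow> 'a"
    and \<mu>0 :: "'a \<Rightarrow> 'a \<Rightarrow> 'a"
    and \<mu> :: "nat \<Rightarrow> 'a \<Rightarrow> 'a \<Rightarrow> 'a"
  assumes "left_alternative_algebra scale \<mu>0"
    and "left_alternative_deformation scale \<mu>0 \<mu>"
    and nontrivial: "\<not> equivalent_deformations scale \<mu> (null_deformation \<mu>0)"
  shows "\<exists>p \<mu>'. p > 0 \<and>
           left_alternative_deformation scale \<mu>0 \<mu>' \<and>
           equivalent_deformations scale \<mu> \<mu>' \<and>
           (\<forall>i. 0 < i \<and> i < p \<longrightarrow> \<mu>' i = (\<lambda>x y. 0)) \<and>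
           \<mu>' p \<in> Z2 scale \<mu>0 \<and> \<mu>' p \<notin> B2 scale \<mu>0"
proof (rule ccontr)
  assume contra: "\<not> ?thesis"
  interpret left_alternative_algebra scale \<mu>0 by fact
  interpret vector_space_pair scale scale ..
  note vs = vector_space_axioms
  have \<mu>_0: "\<mu> 0 = \<mu>0" and bil: "\<And>i. bilinear_map scale (\<mu> i)"
    using assms(2) by (simp_all add: left_alternative_deformation_def)
  have biadd: "biadditive_family \<mu>" using bil by (rule bilinear_imp_biadditive)
  define good where "good n \<Phi> \<longleftrightarrow> \<Phi> 0 = id \<and> (\<forall>i. Vector_Spaces.linear scale scale (\<Phi> i)) \<and>
    (\<forall>i. 0 < i \<and> i \<le> n \<longrightarrow> transport \<mu> \<Phi> i = (\<lambda>x y. 0))" for n \<Phi>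
  \<comment> \<open>Each stage keeps the degrees up to \<open>n\<close> of the previous one, so
    every coefficient is eventually constant along the stages.\<close>
  have "\<exists>F. \<forall>n. good n (F n) \<and> (\<forall>i\<le>n. F (Suc n) i = F n i)"
  proof (rule dependent_nat_choice)
    show "\<exists>\<Phi>. good 0 \<Phi>"
      \<comment> \<open>Any linear family starting with \<open>id\<close> serves here, since at
        stage 0 the vanishing condition is empty.\<close>
      by (rule exI[of _ "\<lambda>_. id"]) (simp add: good_def linear_id)
  next
    fix \<Phi> n
    assume good: "good n \<Phi>"
    let ?\<nu> = "transport \<mu> \<Phi>" and ?n = "Suc n"
    have \<Phi>0: "\<Phi> 0 = id" and \<Phi>: "\<And>i. Vector_Spaces.linear scale scale (\<Phi> i)"
      and low: "\<And>i. 0 < i \<Longrightarrow> i < ?n \<Longrightarrow> ?\<nu> i = (\<lambda>x y. 0)"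
      using good by (auto simp: good_def)
    note \<nu> = transport_deformation[where \<Phi> = \<Phi>, OF vs assms(2) \<Phi> \<Phi>0]
    have "?\<nu> ?n \<in> Z2 scale \<mu>0"
      using \<nu>(1) low by (intro leading_coefficient_in_Z2) auto
    \<comment> \<open>Otherwise \<open>?\<nu>\<close> with \<open>p = ?n\<close> would be a witness
      for the negated claim.\<close>
    then have "?\<nu> ?n \<in> B2 scale \<mu>0"
      using contra \<nu> low by (metis zero_less_Suc)
    then obtain f where f: "Vector_Spaces.linear scale scale f" and eq: "?\<nu> ?n = delta1 \<mu>0 f"
      by (auto simp: B2_def)
    \<comment> \<open>By \<open>transport_add\<close> this subtracts \<open>delta1 \<mu>0 f\<close>,
      which is the whole coefficient of degree \<open>?n\<close>.\<close>
    define \<Psi> where "\<Psi> = \<Phi>(?n := \<lambda>x. \<Phi> ?n x + f x)"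
    have "transport \<mu> \<Psi> i = (\<lambda>x y. 0)" if "0 < i" "i \<le> ?n" for i
    proof (cases "i = ?n")
      case True
      then show ?thesis
        by (intro ext) (simp add: \<Psi>_def transport_add[where \<Phi> = \<Phi>, OF biadd \<Phi>0] \<mu>_0 eq)
    next
      case False
      then have "transport \<mu> \<Psi> i = ?\<nu> i"
        using that by (intro transport_cong) (simp add: \<Psi>_def)
      then show ?thesis using low that False by simp
    qed
    moreover have "Vector_Spaces.linear scale scale (\<Psi> i)" for i
      using \<Phi> f by (simp add: \<Psi>_def linear_compose_add)
    ultimately have "good ?n \<Psi>"
      using \<Phi>0 by (simp add: good_def \<Psi>_def)
    moreover have "\<forall>i\<le>n. \<Psi> i = \<Phi> i"
      by (simp add: \<Psi>_def)
    ultimately show "\<exists>\<Psi>. good ?n \<Psi> \<and> (\<forall>i\<le>n. \<Psi> i = \<Phi> i)"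
      by blast
  qed
  then obtain F where good: "\<And>n. good n (F n)" and step: "\<And>n i. i \<le> n \<Longrightarrow> F (Suc n) i = F n i"
    by blast
  define \<Phi> where "\<Phi> i = F i i" for i
  have "F n i = \<Phi> i" if "i \<le> n" for n i
    using that by (induction n rule: dec_induct) (simp_all add: \<Phi>_def step)
  \<comment> \<open>The diagonal family agrees with \<open>F n\<close> up to degree
    \<open>n\<close>, and coefficient \<open>n\<close> sees no more of it.\<close>
  then have tr: "transport \<mu> \<Phi> n = transport \<mu> (F n) n" for n
    by (intro transport_cong) simp
  have \<Phi>0: "\<Phi> 0 = id" and \<Phi>: "\<And>i. Vector_Spaces.linear scale scale (\<Phi> i)"
    using good by (simp_all add: good_def \<Phi>_def)
  have "transport \<mu> \<Phi> n = null_deformation \<mu>0 n" for n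
  proof (cases "n = 0")
    case True
    then show ?thesis by (simp add: transport_0 \<Phi>0 null_deformation_def \<mu>_0)
  next
    case False
    then show ?thesis using good[of n] by (simp add: tr good_def null_deformation_def)
  qed
  then have "transport \<mu> \<Phi> = null_deformation \<mu>0" ..
  then show False
    using transport_deformation(2)[where \<Phi> = \<Phi>, OF vs assms(2) \<Phi> \<Phi>0] nontrivial by simp
qed

end
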